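(* Let $K$ be a field of characteristic $0$, let $X=\{x_1,\ldots,x_d\}$ be a finite set, and let $\Omega$ be a set of multilinear operations as in the context. Let $G$ be any subgroup of $GL_d(K)$ and suppose that the algebra of invariants $K\{X\}_{\Omega}^G$ contains nonobvious invariants. Then the $\Omega$-algebra $K\{X\}_{\Omega}^G$ is not finitely generated.
   Context: $\Omega=\bigcup_{n\ge 2}\Omega_n$, where $\Omega_n=\{\nu_{ni}\mid i=1,\ldots,p_n\}$ is a finite set (possibly empty) of $n$-ary operation symbols. The free $\Omega$-magma $\{X\}_{\Omega}$ is the set of $\Omega$-monomials: the smallest set of formal expressions containing $X$ and containing $\nu_{ni}(u_1,\ldots,u_n)$ whenever $\nu_{ni}\in\Omega$ and $u_1,\ldots,u_n\in\{X\}_{\Omega}$. The (nonunitary) free $\Omega$-algebra $K\{X\}_{\Omega}$ is the $K$-vector space with basis $\{X\}_{\Omega}$, with the operations of $\Omega$ extended multilinearly. A subalgebra is a subspace closed under all operations in $\Omega$; it is finitely generated if it is generated as an $\Omega$-algebra by finitely many elements. $GL_d(K)$ acts on the vector space $KX$ with basis $X$ by $g(x_j)=\sum_{i=1}^d\alpha_{ij}x_i$ for $g=(\alpha_{ij})$, and this is extended to $K\{X\}_{\Omega}$ by $g(u(x_1,\ldots,x_d))=u(g(x_1),\ldots,g(x_d))$. For a subgroup $G\subseteq GL_d(K)$, $K\{X\}_{\Omega}^G=\{f\in K\{X\}_{\Omega}\mid g(f)=f\text{ for all }g\in G\}$. Every basis of $KX$ is a system of free generators of $K\{X\}_{\Omega}$.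 After a linear change of basis of $KX$ assume that $\{x_1,\ldots,x_{d_0}\}\subseteq X$ is a basis of $(KX)^G=\{v\in KX\mid g(v)=v\text{ for all } g\in G\}$, completed to a basis of $KX$ by $x_{d_0+1},\ldots,x_d$. The elements of $K\{X\}_{\Omega}$ depending only on $x_1,\ldots,x_{d_0}$ (that is, lying in the subalgebra generated by $(KX)^G$) are $G$-invariant; they are called obvious invariants. All other elements of $K\{X\}_{\Omega}^G$ are called nonobvious invariants. *)

theory Defs
  imports "HOL-Analysis.Analysis" "HOL-Algebra.Group" "HOL-Library.Poly_Mapping"
begin

text \<open>
  A signature is a family \<open>\<Omega> :: nat \<Rightarrow> 'o set\<close>, where \<open>\<Omega> n\<close> is the set of \<open>n\<close>-ary operation
  symbols. The arity of an occurrence of a symbol is the number of its arguments, so a name that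
  lies in both \<open>\<Omega> m\<close> and \<open>\<Omega> n\<close> stands for two different operations: the union of the
  \<open>\<Omega> n\<close> is implicitly disjoint.
\<close>

definition signature :: "(nat \<Rightarrow> 'o set) \<Rightarrow> bool"
  where "signature \<Omega> \<longleftrightarrow> (\<forall>n. finite (\<Omega> n)) \<and> (\<forall>n<2. \<Omega> n = {})"

datatype ('o, 'x) mon = Var 'x | Op 'o "('o, 'x) mon list"

inductive_set monomials :: "(nat \<Rightarrow> 'o set) \<Rightarrow> ('o, 'x) mon set"
  for \<Omega> :: "nat \<Rightarrow> 'o set"
  where
    Var: "Var x \<in> monomials \<Omega>"
  | Op: "\<nu> \<in> \<Omega> (length us) \<Longrightarrow> \<forall>u\<in>set us. u \<in> monomials \<Omega> \<Longrightarrow> Op \<nu> us \<in> monomials \<Omega>"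

text \<open>
  Formal linear combinations are finitely supported functions. The type also contains
  combinations of terms that are not built from \<open>\<Omega>\<close>; the algebra \<open>K{X}\<^sub>\<Omega>\<close> itself
  is the set \<open>free_algebra \<Omega>\<close>.
\<close>

type_synonym ('o, 'x, 'k) lincomb = "('o, 'x) mon \<Rightarrow>\<^sub>0 'k"

definition free_algebra :: "(nat \<Rightarrow> 'o set) \<Rightarrow> ('o, 'x, 'k::field) lincomb set"
  where "free_algebra \<Omega> = {f. Poly_Mapping.keys f \<subseteq> monomials \<Omega>}"

definition smult :: "'k::field \<Rightarrow> ('o, 'x, 'k) lincomb \<Rightarrow> ('o, 'x, 'k) lincomb"
  where "smult c f = Poly_Mapping.map ((*) c) f"

lemma lookup_smult: "Poly_Mapping.lookup (smult c f) u = c * Poly_Mapping.lookup f u"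
  by (simp add: smult_def Poly_Mapping.map.rep_eq when_def)

interpretation lincomb: vector_space "smult :: 'k::field \<Rightarrow> ('o, 'x, 'k) lincomb \<Rightarrow> _"
  by unfold_locales (auto intro!: poly_mapping_eqI simp: lookup_smult lookup_add algebra_simps)

text \<open>
  The multilinear extension of \<open>(u\<^sub>1, \<dots>, u\<^sub>n) \<mapsto> \<nu>(u\<^sub>1, \<dots>, u\<^sub>n)\<close>; the sum
  ranges over all choices of one monomial from the support of each argument.
\<close>

definition oper :: "'o \<Rightarrow> ('o, 'x, 'k::field) lincomb list \<Rightarrow> ('o, 'x, 'k) lincomb"
  where "oper \<nu> fs =
    (\<Sum>us \<in> listset (map Poly_Mapping.keys fs).
       Poly_Mapping.single (Op \<nu> us) (prod_list (map2 Poly_Mapping.lookup fs us)))"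

lemma oper_monomials:
  "oper \<nu> (map (\<lambda>u. Poly_Mapping.single u 1) us) = (Poly_Mapping.single (Op \<nu> us) 1 :: ('o, 'x, 'k::field) lincomb)"
proof -
  let ?s = "\<lambda>u. Poly_Mapping.single u 1 :: ('o, 'x, 'k) lincomb"
  have "listset (map Poly_Mapping.keys (map ?s us)) = {us}"
    by (induction us) (auto simp: set_Cons_def)
  moreover have "prod_list (map2 Poly_Mapping.lookup (map ?s us) us) = 1"
    by (induction us) auto
  ultimately show ?thesis
    by (simp add: oper_def)
qed

definition subalgebra :: "(nat \<Rightarrow> 'o set) \<Rightarrow> ('o, 'x, 'k::field) lincomb set \<Rightarrow> bool"
  where "subalgebra \<Omega> A \<longleftrightarrow>
    A \<subseteq> free_algebra \<Omega> \<and> lincomb.subspace A \<and>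
    (\<forall>\<nu> fs. \<nu> \<in> \<Omega> (length fs) \<longrightarrow> set fs \<subseteq> A \<longrightarrow> oper \<nu> fs \<in> A)"

text \<open>\<open>subalgebra \<Omega> hull S\<close> is the subalgebra generated by \<open>S\<close>.\<close>

definition finitely_generated :: "(nat \<Rightarrow> 'o set) \<Rightarrow> ('o, 'x, 'k::field) lincomb set \<Rightarrow> bool"
  where "finitely_generated \<Omega> A \<longleftrightarrow> (\<exists>S. finite S \<and> S \<subseteq> A \<and> A = subalgebra \<Omega> hull S)"

definition GL :: "('k::field ^ 'd ^ 'd) monoid"
  where "GL = \<lparr>carrier = {g. invertible g}, mult = (**), one = mat 1\<rparr>"

lemma group_GL: "group (GL :: ('k::field ^ 'd ^ 'd) monoid)"
proof (rule groupI)
  fix g :: "'k ^ 'd ^ 'd"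
  assume "g \<in> carrier GL"
  then obtain h where "g ** h = mat 1" "h ** g = mat 1"
    by (auto simp: GL_def invertible_def)
  then show "\<exists>h\<in>carrier GL. h \<otimes>\<^bsub>GL\<^esub> g = \<one>\<^bsub>GL\<^esub>"
    by (auto simp: GL_def invertible_def)
next
  show "\<one>\<^bsub>GL\<^esub> \<in> carrier (GL :: ('k ^ 'd ^ 'd) monoid)"
    by (auto simp: GL_def invertible_def)
qed (auto simp: GL_def invertible_mult matrix_mul_assoc)

definition var :: "'x \<Rightarrow> ('o, 'x, 'k::field) lincomb"
  where "var x = Poly_Mapping.single (Var x) 1"

text \<open>Substitution \<open>u(x\<^sub>1, \<dots>, x\<^sub>d) \<mapsto> u(\<phi> x\<^sub>1, \<dots>, \<phi> x\<^sub>d)\<close>, first on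
  monomials and then extended linearly.\<close>

primrec subst_mon :: "('x \<Rightarrow> ('o, 'x, 'k::field) lincomb) \<Rightarrow> ('o, 'x) mon \<Rightarrow> ('o, 'x, 'k) lincomb"
  where
    "subst_mon \<phi> (Var x) = \<phi> x"
  | "subst_mon \<phi> (Op \<nu> us) = oper \<nu> (map (subst_mon \<phi>) us)"

definition subst :: "('x \<Rightarrow> ('o, 'x, 'k::field) lincomb) \<Rightarrow> ('o, 'x, 'k) lincomb \<Rightarrow> ('o, 'x, 'k) lincomb"
  where "subst \<phi> f = (\<Sum>u\<in>Poly_Mapping.keys f. smult (Poly_Mapping.lookup f u) (subst_mon \<phi> u))"

text \<open>The entry \<open>\<alpha>\<^sub>i\<^sub>j\<close> of the matrix \<open>g\<close> is \<open>g $ i $ j\<close>.\<close>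

definition act :: "'k::field ^ 'd ^ 'd \<Rightarrow> ('o, 'd, 'k) lincomb \<Rightarrow> ('o, 'd, 'k) lincomb"
  where "act g = subst (\<lambda>j. \<Sum>i\<in>UNIV. smult (g $ i $ j) (var i))"

definition invariants ::
  "(nat \<Rightarrow> 'o set) \<Rightarrow> ('k::field ^ 'd ^ 'd) set \<Rightarrow> ('o, 'd, 'k) lincomb set"
  where "invariants \<Omega> G = {f \<in> free_algebra \<Omega>. \<forall>g\<in>G. act g f = f}"

definition linear_invariants :: "('k::field ^ 'd ^ 'd) set \<Rightarrow> ('o, 'd, 'k) lincomb set"
  where "linear_invariants G = {v \<in> lincomb.span (range var). \<forall>g\<in>G. act g v = v}"

text \<open>The coordinate-free form of ``depending only on \<open>x\<^sub>1, \<dots>, x\<^sub>d\<^sub>0\<close>'', where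
  these elements form a basis of \<open>(KX)\<^sup>G\<close>.\<close>

definition obvious_invariants ::
  "(nat \<Rightarrow> 'o set) \<Rightarrow> ('k::field ^ 'd ^ 'd) set \<Rightarrow> ('o, 'd, 'k) lincomb set"
  where "obvious_invariants \<Omega> G = subalgebra \<Omega> hull linear_invariants G"

definition nonobvious_invariants ::
  "(nat \<Rightarrow> 'o set) \<Rightarrow> ('k::field ^ 'd ^ 'd) set \<Rightarrow> ('o, 'd, 'k) lincomb set"
  where "nonobvious_invariants \<Omega> G = invariants \<Omega> G - obvious_invariants \<Omega> G"

end

theory Submission
  imports Defs
begin

text \<open>
  Sorting the monomials by their shape (the tree with the variables at its leaves erased) splits
  \<open>K{X}\<^sub>\<Omega>\<close> into tensor powers: the component of a shape with \<open>n\<close> leaves is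
  \<open>V\<^sup>\<otimes>\<^sup>n\<close> with \<open>V = KX\<close>, and a matrix acts on it as the \<open>n\<close>-th tensor power of the
  matrix (\<open>lookup_act\<close>). Invariance therefore only concerns the tensors, not the shapes: any
  \<open>G\<close>-invariant tensor of degree \<open>n\<close> may be placed on any shape with \<open>n\<close> leaves, and
  invariant tensors may be multiplied and have their tensor factors permuted. This freedom is what
  makes new generators appear in arbitrarily high degree.

  Let \<open>W = V\<^sup>G\<close>. If all tensors of an invariant \<open>f\<close> had all their slots in \<open>W\<close>, then a
  projection \<open>P\<close> of \<open>V\<close> onto \<open>W\<close> would leave \<open>f\<close> unchanged, and \<open>f = P(f)\<close> would be a
  substitution of elements of \<open>W\<close> into \<open>f\<close>, that is, an obvious invariant. So a nonobvious
  invariant has a tensor component \<open>c\<close>, of degree \<open>n\<close> say, with a slot outside \<open>W\<close>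
  (\<open>ex_nonfixed_slot\<close>); here \<open>n \<ge> 2\<close>, as the invariant tensors of degree 1 are the elements
  of \<open>W\<close>. Move this slot to the front and multiply by a power of \<open>c\<close>. The result is an
  invariant tensor whose first slot is outside \<open>W\<close>. Its degree is a multiple of \<open>n\<close>, and
  there are arbitrarily large multiples of \<open>n\<close> that are the number of leaves of a shape
  \<open>\<mu>(x, \<dots>)\<close> whose first argument is a single leaf
  (\<open>ex_shape_with_leading_leaf\<close>). On such a shape the tensor gives an invariant \<open>h\<close>
  (\<open>ex_large_invariant_with_nonfixed_leading_leaf\<close>).

  Finally, \<open>h\<close> is not generated by invariants of smaller degree. In a product
  \<open>\<mu>(f\<^sub>1, \<dots>, f\<^sub>m)\<close> the coefficients at the monomials \<open>\<mu>(x\<^sub>j, \<dots>)\<close>, as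
  \<open>j\<close> varies, are proportional to those of the linear part of \<open>f\<^sub>1\<close>, which lies in \<open>W\<close> when
  \<open>f\<^sub>1\<close> is invariant. The condition that the linear part and this vector of coefficients lie in
  \<open>W\<close> thus defines a subalgebra (\<open>subalgebra_leading_leaf_fixed\<close>). It contains every invariant
  of smaller degree, since for these the coefficients in question vanish, but not \<open>h\<close>.
\<close>

section \<open>Shapes and leaves of monomials\<close>

primrec leaves :: "('o, 'x) mon \<Rightarrow> 'x list"
  where
    "leaves (Var x) = [x]"
  | "leaves (Op \<nu> us) = concat (map leaves us)"

definition shape :: "('o, 'x) mon \<Rightarrow> ('o, unit) mon"
  where "shape u = map_mon id (\<lambda>_. ()) u"

lemma shape_simps [simp]:
  "shape (Var x) = Var ()"
  "shape (Op \<nu> us) = Op \<nu> (map shape us)"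
  by (simp_all add: shape_def)

lemma shape_eq_Var_iff [simp]: "shape u = Var () \<longleftrightarrow> (\<exists>x. u = Var x)"
  by (cases u) auto

lemma shape_eq_Op_iff: "shape u = Op \<nu> ss \<longleftrightarrow> (\<exists>us. u = Op \<nu> us \<and> map shape us = ss)"
  by (cases u) auto

lemma length_leaves_shape [simp]: "length (leaves (shape u)) = length (leaves u)"
  by (induction u) (simp_all add: length_concat o_def cong: map_cong)

lemma monomials_Op_iff:
  "Op \<nu> us \<in> monomials \<Omega> \<longleftrightarrow> \<nu> \<in> \<Omega> (length us) \<and> (\<forall>u\<in>set us. u \<in> monomials \<Omega>)"
  by (auto intro: monomials.Op elim: monomials.cases)

lemma shape_in_monomials_iff [simp]: "shape u \<in> monomials \<Omega> \<longleftrightarrow> u \<in> monomials \<Omega>"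
  by (induction u) (auto simp: monomials_Op_iff intro: monomials.Var)

lemma eq_if_shape_leaves_eq: "shape u = shape v \<Longrightarrow> leaves u = leaves v \<Longrightarrow> u = v"
proof (induction u arbitrary: v)
  case (Var x)
  then show ?case by (cases v) auto
next
  case (Op \<nu> us)
  then obtain vs where v: "v = Op \<nu> vs" and sh: "map shape us = map shape vs"
    by (cases v) auto
  have len: "length us = length vs"
    using sh by (metis length_map)
  have sh': "shape (us ! i) = shape (vs ! i)" if "i < length us" for i
    using sh len that by (metis nth_map)
  have "length (leaves (us ! i)) = length (leaves (vs ! i))" if "i < length us" for i
    using sh'[OF that] by (metis length_leaves_shape)
  then have "map leaves us = map leaves vs"
    using Op.prems(2) len v
    by (intro concat_injective) (auto simp: set_zip)
  then have "leaves (us ! i) = leaves (vs ! i)" if "i < length us" for i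
    using len that by (metis nth_map)
  then have "us = vs"
    using len sh' Op.IH by (intro nth_equalityI) auto
  then show ?case using v by simp
qed

lemma ex_shape_leaves:
  "length w = length (leaves s) \<Longrightarrow> \<exists>u. shape u = s \<and> leaves u = w"
proof (induction s arbitrary: w)
  case (Var x)
  then show ?case by (auto simp: length_Suc_conv)
next
  case (Op \<nu> ss)
  have "\<exists>us. map shape us = ss \<and> concat (map leaves us) = w"
    using Op
  proof (induction ss arbitrary: w)
    case Nil
    then show ?case by simp
  next
    case (Cons s ss)
    let ?n = "length (leaves s)"
    obtain u where u: "shape u = s" "leaves u = take ?n w"
      using Cons.prems(1)[of s "take ?n w"] Cons.prems(2) by auto
    obtain us where us: "map shape us = ss" "concat (map leaves us) = drop ?n w"
      using Cons.IH[of "drop ?n w"] Cons.prems by auto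
    from u us have "map shape (u # us) = s # ss \<and> concat (map leaves (u # us)) = w"
      by simp
    then show ?case by (rule exI)
  qed
  then obtain us where "map shape us = ss" "concat (map leaves us) = w"
    by blast
  then have "shape (Op \<nu> us) = Op \<nu> ss \<and> leaves (Op \<nu> us) = w"
    by simp
  then show ?case by (rule exI)
qed

lemma bij_betw_leaves:
  "bij_betw leaves {u. shape u = s} {w. length w = length (leaves s)}"
proof (rule bij_betw_imageI)
  show "inj_on leaves {u. shape u = s}"
    by (auto intro!: inj_onI intro: eq_if_shape_leaves_eq)
  show "leaves ` {u. shape u = s} = {w. length w = length (leaves s)}"
  proof (intro equalityI subsetI)
    fix w assume "w \<in> {w. length w = length (leaves s)}"
    then show "w \<in> leaves ` {u. shape u = s}"
      using ex_shape_leaves[of w s] by (force simp: image_iff)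
  qed auto
qed

definition fill :: "('o, unit) mon \<Rightarrow> 'x list \<Rightarrow> ('o, 'x) mon"
  where "fill s = inv_into {u. shape u = s} leaves"

lemma
  assumes "length w = length (leaves s)"
  shows shape_fill: "shape (fill s w) = s" and leaves_fill: "leaves (fill s w) = w"
proof -
  have "w \<in> leaves ` {u. shape u = s}"
    using bij_betw_leaves[of s] assms by (auto simp: bij_betw_def)
  from inv_into_into[OF this] f_inv_into_f[OF this]
  show "shape (fill s w) = s" "leaves (fill s w) = w"
    by (simp_all add: fill_def)
qed

lemma fill_shape_leaves [simp]: "fill (shape u) (leaves u) = u"
  by (rule eq_if_shape_leaves_eq) (simp_all add: shape_fill leaves_fill)

lemma finite_lists_of_length: "finite {w :: 'd::finite list. length w = n}"
  using finite_lists_length_eq[of "UNIV :: 'd set" n] by simp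

lemma finite_shape_eq: "finite {u :: ('o, 'd::finite) mon. shape u = s}"
  using bij_betw_finite[OF bij_betw_leaves] finite_lists_of_length by blast


section \<open>The action in terms of coefficients\<close>

lemma mem_listset_iff: "us \<in> listset As \<longleftrightarrow> list_all2 (\<in>) us As"
  by (induction As arbitrary: us) (auto simp: set_Cons_def list_all2_Cons2)

lemma finite_listset: "\<forall>A\<in>set As. finite A \<Longrightarrow> finite (listset As)"
  by (induction As) (auto simp: set_Cons_def intro: finite_image_set2)

lemma lookup_oper_Op:
  "Poly_Mapping.lookup (oper \<nu> fs) (Op \<mu> us) =
    (if \<mu> = \<nu> \<and> length us = length fs then prod_list (map2 Poly_Mapping.lookup fs us) else 0)"
proof -
  let ?A = "listset (map Poly_Mapping.keys fs)"
  have fin: "finite ?A" by (rule finite_listset) auto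
  have "Poly_Mapping.lookup (oper \<nu> fs) (Op \<mu> us) =
      (\<Sum>ws\<in>?A. if us = ws then if \<mu> = \<nu> then prod_list (map2 Poly_Mapping.lookup fs us) else 0 else 0)"
    unfolding oper_def lookup_sum
    by (intro sum.cong) (auto simp: lookup_single when_def)
  also have "\<dots> = (if us \<in> ?A \<and> \<mu> = \<nu> then prod_list (map2 Poly_Mapping.lookup fs us) else 0)"
    using fin by simp
  also have "\<dots> = (if \<mu> = \<nu> \<and> length us = length fs then prod_list (map2 Poly_Mapping.lookup fs us) else 0)"
  proof -
    have "length us = length fs" if "us \<in> ?A"
      using that by (auto simp: mem_listset_iff dest: list_all2_lengthD)
    moreover have "prod_list (map2 Poly_Mapping.lookup fs us) = 0"
      if "length us = length fs" "us \<notin> ?A"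
      using that
    proof (induction us fs rule: list_induct2)
      case (Cons u us f fs)
      then show ?case by (auto simp: mem_listset_iff in_keys_iff simp del: listset.simps)
    qed (simp add: mem_listset_iff)
    ultimately show ?thesis by auto
  qed
  finally show ?thesis .
qed

lemma lookup_oper_Var: "Poly_Mapping.lookup (oper \<nu> fs) (Var x) = 0"
  unfolding oper_def lookup_sum by (simp add: lookup_single)

text \<open>
  The coefficient of the word \<open>v\<close> in \<open>g(w\<^sub>1) \<otimes> \<dots> \<otimes> g(w\<^sub>n)\<close>.
\<close>

definition weight :: "'k::field ^ 'd ^ 'd \<Rightarrow> 'd list \<Rightarrow> 'd list \<Rightarrow> 'k"
  where "weight g v w = prod_list (map2 (\<lambda>i j. g $ i $ j) v w)"

lemma weight_simps [simp]:
  "weight g [] w = 1"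
  "weight g (i # v) (j # w) = g $ i $ j * weight g v w"
  by (simp_all add: weight_def)

lemma weight_append:
  "length v = length w \<Longrightarrow> weight g (v @ v') (w @ w') = weight g v w * weight g v' w'"
  by (simp add: weight_def)

lemma lookup_act_var:
  "Poly_Mapping.lookup (\<Sum>i\<in>UNIV. smult (g $ i $ j) (var i)) v =
    (case v of Var i \<Rightarrow> g $ i $ j | Op _ _ \<Rightarrow> 0)"
  for g :: "'k::field ^ 'd::finite ^ 'd"
proof (cases v)
  case (Var k)
  have "Poly_Mapping.lookup (\<Sum>i\<in>UNIV. smult (g $ i $ j) (var i)) v =
      (\<Sum>i\<in>UNIV. if i = k then g $ i $ j else 0)"
    unfolding lookup_sum Var
    by (intro sum.cong) (auto simp: lookup_smult var_def lookup_single when_def)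
  then show ?thesis using Var by simp
qed (simp add: lookup_sum lookup_smult var_def lookup_single)

lemma lookup_subst_mon:
  fixes g :: "'k::field ^ 'd::finite ^ 'd"
  shows "Poly_Mapping.lookup (subst_mon (\<lambda>j. \<Sum>i\<in>UNIV. smult (g $ i $ j) (var i)) u) v =
    (if shape u = shape v then weight g (leaves v) (leaves u) else 0)"
proof (induction u arbitrary: v)
  case (Var j)
  then show ?case by (cases v) (simp_all add: lookup_act_var)
next
  case (Op \<nu> us)
  let ?\<sigma> = "subst_mon (\<lambda>j. \<Sum>i\<in>UNIV. smult (g $ i $ j) (var i))"
  show ?case
  proof (cases v)
    case (Var i)
    then show ?thesis by (simp add: lookup_oper_Var)
  next
    case v: (Op \<mu> vs)
    have "prod_list (map2 Poly_Mapping.lookup (map ?\<sigma> us) vs) =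
        (if map shape us = map shape vs
         then weight g (concat (map leaves vs)) (concat (map leaves us)) else 0)"
      if "length us = length vs"
      using that Op.IH
    proof (induction us vs rule: list_induct2)
      case (Cons u us v vs)
      have "length (leaves v) = length (leaves u)" if "shape u = shape v"
        using that by (metis length_leaves_shape)
      then show ?case using Cons by (auto simp: weight_append)
    qed simp
    moreover have "length us = length vs" if "map shape us = map shape vs"
      using that by (metis length_map)
    ultimately show ?thesis
      using v by (auto simp: lookup_oper_Op)
  qed
qed

text \<open>
  A function on words stands for the tensors of all degrees at once: its values at the words of
  length \<open>n\<close> are the coordinates of a tensor in \<open>V\<^sup>\<otimes>\<^sup>n\<close>, and \<open>tensor_act\<close> is the
  \<open>n\<close>-th tensor power of \<open>g\<close> on them. Recursion on the word, one slot at a time, makes the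
  later facts on products and permutations direct inductions; the closed form as a sum is only needed
  to compare with the action on \<open>K{X}\<^sub>\<Omega>\<close>.
\<close>

primrec tensor_act :: "'k::field ^ 'd ^ 'd \<Rightarrow> ('d list \<Rightarrow> 'k) \<Rightarrow> 'd list \<Rightarrow> 'k"
  where
    "tensor_act g c [] = c []"
  | "tensor_act g c (i # v) = (\<Sum>j\<in>UNIV. g $ i $ j * tensor_act g (\<lambda>w. c (j # w)) v)"

lemma tensor_act_eq_sum_weight:
  fixes g :: "'k::field ^ 'd::finite ^ 'd"
  shows "tensor_act g c v = (\<Sum>w | length w = length v. c w * weight g v w)"
proof (induction v arbitrary: c)
  case (Cons i v)
  let ?L = "{w :: 'd list. length w = length v}"
  have inj: "inj_on (\<lambda>(j, w). j # w) (UNIV \<times> ?L)"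
    by (auto simp: inj_on_def)
  have img: "{w. length w = length (i # v)} = (\<lambda>(j, w). j # w) ` (UNIV \<times> ?L)"
    by (auto simp: length_Suc_conv)
  have "tensor_act g c (i # v) = (\<Sum>j\<in>UNIV. \<Sum>w\<in>?L. c (j # w) * weight g (i # v) (j # w))"
    by (simp add: Cons.IH sum_distrib_left mult_ac)
  also have "\<dots> = (\<Sum>w | length w = length (i # v). c w * weight g (i # v) w)"
    unfolding img sum.reindex[OF inj] sum.cartesian_product
    by (intro sum.cong) auto
  finally show ?case .
qed simp

definition component :: "('o, unit) mon \<Rightarrow> ('o, 'x, 'k::field) lincomb \<Rightarrow> 'x list \<Rightarrow> 'k"
  where "component s f w = Poly_Mapping.lookup f (fill s w)"

text \<open>
  The image of a monomial under substitution of linear forms is a combination of monomials of the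
  same shape, so the action splits along shapes. On each of them it depends only on the number of
  leaves.
\<close>

lemma lookup_act:
  fixes g :: "'k::field ^ 'd::finite ^ 'd"
  shows "Poly_Mapping.lookup (act g f) v = tensor_act g (component (shape v) f) (leaves v)"
proof -
  let ?U = "{u. shape u = shape v}"
  have "Poly_Mapping.lookup (act g f) v =
      (\<Sum>u\<in>Poly_Mapping.keys f. Poly_Mapping.lookup f u *
        (if shape u = shape v then weight g (leaves v) (leaves u) else 0))"
    by (simp add: act_def subst_def lookup_sum lookup_smult lookup_subst_mon)
  also have "\<dots> = (\<Sum>u\<in>?U. Poly_Mapping.lookup f u * weight g (leaves v) (leaves u))"
    by (rule sum.mono_neutral_cong) (auto simp: finite_shape_eq in_keys_iff)
  also have "\<dots> = (\<Sum>u\<in>?U. component (shape v) f (leaves u) * weight g (leaves v) (leaves u))"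
    by (intro sum.cong refl) (metis (mono_tags, lifting) component_def fill_shape_leaves mem_Collect_eq)
  also have "\<dots> = tensor_act g (component (shape v) f) (leaves v)"
    unfolding tensor_act_eq_sum_weight
    by (subst sum.reindex_bij_betw[OF bij_betw_leaves]) simp
  finally show ?thesis .
qed

section \<open>Invariant tensors\<close>

lemma tensor_act_cong:
  "(\<And>w. length w = length v \<Longrightarrow> c w = d w) \<Longrightarrow> tensor_act g c v = tensor_act g d v"
proof (induction v arbitrary: c d)
  case (Cons i v)
  have "tensor_act g (\<lambda>w. c (j # w)) v = tensor_act g (\<lambda>w. d (j # w)) v" for j
    by (rule Cons.IH) (simp add: Cons.prems)
  then show ?case by simp
qed simp

lemma tensor_act_scale: "tensor_act g (\<lambda>w. a * c w) v = a * tensor_act g c v"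
  by (induction v arbitrary: c) (simp_all add: sum_distrib_left mult_ac)

definition tensor_invariant :: "('k::field ^ 'd ^ 'd) set \<Rightarrow> nat \<Rightarrow> ('d list \<Rightarrow> 'k) \<Rightarrow> bool"
  where "tensor_invariant G n c \<longleftrightarrow> (\<forall>g\<in>G. \<forall>v. length v = n \<longrightarrow> tensor_act g c v = c v)"

definition fixed_vectors :: "('k::field ^ 'd ^ 'd) set \<Rightarrow> ('k ^ 'd) set"
  where "fixed_vectors G = {a. \<forall>g\<in>G. g *v a = a}"

lemma subspace_fixed_vectors: "vec.subspace (fixed_vectors G)"
  for G :: "('k::field ^ 'd::finite ^ 'd) set"
  by (auto simp: vec.subspace_def fixed_vectors_def matrix_vector_right_distrib vec.scale)

lemma tensor_invariant_degree_1_iff: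
  fixes G :: "('k::field ^ 'd::finite ^ 'd) set"
  shows "tensor_invariant G 1 c \<longleftrightarrow> (\<chi> j. c [j]) \<in> fixed_vectors G"
proof -
  have "(\<forall>v :: 'd list. length v = 1 \<longrightarrow> Q v) \<longleftrightarrow> (\<forall>i. Q [i])" for Q
    by (auto simp: length_Suc_conv)
  then show ?thesis
    by (simp add: tensor_invariant_def fixed_vectors_def vec_eq_iff matrix_vector_mult_def)
qed

definition tensor_prod ::
    "nat \<Rightarrow> ('d list \<Rightarrow> 'k::field) \<Rightarrow> ('d list \<Rightarrow> 'k) \<Rightarrow> 'd list \<Rightarrow> 'k"
  where "tensor_prod n c d w = c (take n w) * d (drop n w)"

lemma tensor_act_prod:
  "tensor_act g (tensor_prod (length v) c d) (v @ w) = tensor_act g c v * tensor_act g d w"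
proof (induction v arbitrary: c)
  case Nil
  then show ?case by (simp add: tensor_prod_def tensor_act_scale)
next
  case (Cons i v)
  have "(\<lambda>w. tensor_prod (length (i # v)) c d (j # w)) = tensor_prod (length v) (\<lambda>w. c (j # w)) d" for j
    by (simp add: tensor_prod_def fun_eq_iff)
  then show ?case
    by (simp add: Cons.IH sum_distrib_left sum_distrib_right mult_ac)
qed

lemma tensor_invariant_prod:
  fixes G :: "('k::field ^ 'd::finite ^ 'd) set"
  assumes "tensor_invariant G n c" "tensor_invariant G m d"
  shows "tensor_invariant G (n + m) (tensor_prod n c d)"
  unfolding tensor_invariant_def
proof (intro ballI allI impI)
  fix g and v :: "'d list" assume g: "g \<in> G" and len: "length v = n + m"
  have "tensor_act g (tensor_prod n c d) v = tensor_act g c (take n v) * tensor_act g d (drop n v)"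
    using tensor_act_prod[of g "take n v" c d "drop n v"] len by simp
  also have "\<dots> = tensor_prod n c d v"
    using assms g len by (simp add: tensor_invariant_def tensor_prod_def)
  finally show "tensor_act g (tensor_prod n c d) v = tensor_prod n c d v" .
qed

primrec tensor_power :: "nat \<Rightarrow> ('d list \<Rightarrow> 'k::field) \<Rightarrow> nat \<Rightarrow> 'd list \<Rightarrow> 'k"
  where
    "tensor_power n c 0 = (\<lambda>_. 1)"
  | "tensor_power n c (Suc m) = tensor_prod n c (tensor_power n c m)"

lemma tensor_invariant_power:
  "tensor_invariant G n c \<Longrightarrow> tensor_invariant G (n * m) (tensor_power n c m)"
proof (induction m)
  case 0
  then show ?case by (simp add: tensor_invariant_def)
next
  case (Suc m)
  then show ?case using tensor_invariant_prod[of G n c "n * m"] by simp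
qed

lemma tensor_power_concat_replicate:
  "length u = n \<Longrightarrow> tensor_power n c m (concat (replicate m u)) = c u ^ m"
  by (induction m) (simp_all add: tensor_prod_def)

definition slot_to_front :: "nat \<Rightarrow> ('d list \<Rightarrow> 'k) \<Rightarrow> 'd list \<Rightarrow> 'k"
  where "slot_to_front i c w = c (take i (tl w) @ hd w # drop i (tl w))"

text \<open>
  The instance for a cyclic permutation of the fact that permutations of the tensor factors commute
  with the action.
\<close>

lemma tensor_act_slot_to_front:
  "i \<le> length v \<Longrightarrow>
    tensor_act g (slot_to_front i c) (a # v) = tensor_act g c (take i v @ a # drop i v)"
proof (induction i arbitrary: c v)
  case 0
  then show ?case by (simp add: slot_to_front_def)
next
  case (Suc i)
  then obtain b v' where v: "v = b # v'" "i \<le> length v'"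
    by (cases v) auto
  have eq: "(\<lambda>w. slot_to_front (Suc i) c (j # k # w)) = (\<lambda>w. slot_to_front i (\<lambda>w. c (k # w)) (j # w))" for j k
    by (simp add: slot_to_front_def)
  have "tensor_act g (slot_to_front (Suc i) c) (a # v) =
      (\<Sum>j\<in>UNIV. \<Sum>k\<in>UNIV. g $ a $ j * (g $ b $ k *
        tensor_act g (\<lambda>w. slot_to_front i (\<lambda>w. c (k # w)) (j # w)) v'))"
    unfolding v by (simp add: eq sum_distrib_left)
  also have "\<dots> = (\<Sum>k\<in>UNIV. g $ b $ k * tensor_act g (slot_to_front i (\<lambda>w. c (k # w))) (a # v'))"
    by (subst sum.swap) (simp add: sum_distrib_left mult_ac)
  also have "\<dots> = tensor_act g c (take (Suc i) v @ a # drop (Suc i) v)"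
    using v Suc.IH[of v'] by simp
  finally show ?case .
qed

lemma tensor_invariant_slot_to_front:
  fixes G :: "('k::field ^ 'd::finite ^ 'd) set"
  assumes "tensor_invariant G (Suc n) c" "i \<le> n"
  shows "tensor_invariant G (Suc n) (slot_to_front i c)"
  unfolding tensor_invariant_def
proof (intro ballI allI impI)
  fix g and w :: "'d list" assume "g \<in> G" and "length w = Suc n"
  then obtain a v where "w = a # v" "length v = n"
    by (cases w) auto
  with assms \<open>g \<in> G\<close> show "tensor_act g (slot_to_front i c) w = slot_to_front i c w"
    by (simp add: tensor_act_slot_to_front tensor_invariant_def del: tensor_act.simps)
      (simp add: slot_to_front_def)
qed

text \<open>
  A tensor with each slot in the fixed space of \<open>P\<close> is fixed by the tensor power of \<open>P\<close>, since
  \<open>P\<close> may be applied to the slots one after the other.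
\<close>

lemma tensor_act_eq_if_slots_fixed:
  fixes P :: "'k::field ^ 'd::finite ^ 'd"
  assumes "\<And>xs ys. Suc (length xs + length ys) = length v \<Longrightarrow>
    P *v (\<chi> j. c (xs @ j # ys)) = (\<chi> j. c (xs @ j # ys))"
  shows "tensor_act P c v = c v"
  using assms
proof (induction v arbitrary: c)
  case (Cons i v)
  have "tensor_act P (\<lambda>w. c (j # w)) v = c (j # v)" for j
    using Cons.prems[of "j # xs" ys for xs ys] by (intro Cons.IH) simp
  then have "tensor_act P c (i # v) = (P *v (\<chi> j. c (j # v))) $ i"
    by (simp add: matrix_vector_mult_def)
  also have "\<dots> = c (i # v)"
    using Cons.prems[of "[]" v] by simp
  finally show ?case .
qed simp

lemma ex_projection_onto_subspace:
  fixes W :: "('k::field ^ 'd::finite) set"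
  assumes "vec.subspace W"
  obtains P :: "'k ^ 'd ^ 'd" where "\<And>a. P *v a \<in> W" "\<And>a. a \<in> W \<Longrightarrow> P *v a = a"
proof -
  have "Vector_Spaces.linear (*s) (*s) (id :: 'k ^ 'd \<Rightarrow> 'k ^ 'd)"
    by (rule vec.linear_id)
  from vec.linear_exists_left_inverse_on[OF this assms]
  obtain h :: "'k ^ 'd \<Rightarrow> 'k ^ 'd" where h: "range h \<subseteq> W" "Vector_Spaces.linear (*s) (*s) h" "\<forall>a\<in>W. h a = a"
    by auto
  with that[of "matrix h"] show thesis
    by (auto simp: matrix_works)
qed

section \<open>Invariants of the free algebra and invariant tensors\<close>

lemma tensor_invariant_component:
  fixes f :: "('o, 'd::finite, 'k::field) lincomb"
  assumes "f \<in> invariants \<Omega> G"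
  shows "tensor_invariant G (length (leaves s)) (component s f)"
  unfolding tensor_invariant_def
proof (intro ballI allI impI)
  fix g and v :: "'d list" assume "g \<in> G" and v: "length v = length (leaves s)"
  then have "Poly_Mapping.lookup (act g f) (fill s v) = Poly_Mapping.lookup f (fill s v)"
    using assms by (simp add: invariants_def)
  with v show "tensor_act g (component s f) v = component s f v"
    by (simp add: lookup_act shape_fill leaves_fill component_def)
qed

definition realize ::
    "('o, unit) mon \<Rightarrow> ('x::finite list \<Rightarrow> 'k::field) \<Rightarrow> ('o, 'x, 'k) lincomb"
  where "realize s c = (\<Sum>u | shape u = s. Poly_Mapping.single u (c (leaves u)))"

lemma lookup_realize:
  "Poly_Mapping.lookup (realize s c) v = (if shape v = s then c (leaves v) else 0)"
proof -
  have "Poly_Mapping.lookup (realize s c) v = (\<Sum>u | shape u = s. if u = v then c (leaves v) else 0)"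
    unfolding realize_def lookup_sum
    by (intro sum.cong) (auto simp: lookup_single when_def)
  then show ?thesis by (simp add: finite_shape_eq)
qed

text \<open>
  Together with \<open>tensor_invariant_component\<close>: an invariant tensor found on one shape can be
  transferred to every other shape with the same number of leaves.
\<close>

lemma realize_in_invariants:
  fixes G :: "('k::field ^ 'd::finite ^ 'd) set" and s :: "('o, unit) mon"
  assumes "s \<in> monomials \<Omega>" "tensor_invariant G (length (leaves s)) c"
  shows "realize s c \<in> invariants \<Omega> G"
proof -
  have "Poly_Mapping.keys (realize s c) \<subseteq> monomials \<Omega>"
    using assms(1) shape_in_monomials_iff
    by (fastforce simp: in_keys_iff lookup_realize split: if_splits)
  moreover have "act g (realize s c) = realize s c" if "g \<in> G" for g
  proof (rule poly_mapping_eqI)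
    fix v :: "('o, 'd) mon"
    have comp: "component (shape v) (realize s c) w = (if shape v = s then c w else 0)"
      if "length w = length (leaves v)" for w
      using that by (auto simp: component_def lookup_realize shape_fill leaves_fill)
    have "Poly_Mapping.lookup (act g (realize s c)) v =
        tensor_act g (\<lambda>w. (if shape v = s then 1 else 0) * c w) (leaves v)"
      unfolding lookup_act by (rule tensor_act_cong) (simp add: comp)
    also have "\<dots> = Poly_Mapping.lookup (realize s c) v"
      using assms(2) that by (auto simp: tensor_act_scale lookup_realize tensor_invariant_def)
    finally show "Poly_Mapping.lookup (act g (realize s c)) v = Poly_Mapping.lookup (realize s c) v" .
  qed
  ultimately show ?thesis
    by (simp add: invariants_def free_algebra_def)
qed

lemma linear_form_in_linear_invariants:
  fixes G :: "('k::field ^ 'd::finite ^ 'd) set"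
  assumes "a \<in> fixed_vectors G"
  shows "(\<Sum>i\<in>UNIV. smult (a $ i) (var i)) \<in> (linear_invariants G :: ('o, 'd, 'k) lincomb set)"
proof -
  let ?v = "\<Sum>i\<in>UNIV. smult (a $ i) (var i) :: ('o, 'd, 'k) lincomb"
  have "tensor_invariant G (length (leaves (Var () :: ('o, unit) mon))) (\<lambda>w. a $ hd w)"
    using assms tensor_invariant_degree_1_iff[of G "\<lambda>w. a $ hd w"] by simp
  \<comment> \<open>The signature does not matter for a linear form, as variables are monomials over each signature.\<close>
  then have "realize (Var ()) (\<lambda>w. a $ hd w) \<in> (invariants (\<lambda>_. {}) G :: ('o, 'd, 'k) lincomb set)"
    by (intro realize_in_invariants monomials.Var)
  moreover have "realize (Var ()) (\<lambda>w. a $ hd w) = ?v"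
  proof (rule poly_mapping_eqI)
    fix u
    show "Poly_Mapping.lookup (realize (Var ()) (\<lambda>w. a $ hd w)) u = Poly_Mapping.lookup ?v u"
      using lookup_act_var[of "\<chi> i j. a $ i" undefined u]
      by (simp add: lookup_realize split: mon.splits)
  qed
  moreover have "?v \<in> lincomb.span (range var)"
    by (intro lincomb.span_sum lincomb.span_scale lincomb.span_base) auto
  ultimately show ?thesis
    by (simp add: invariants_def linear_invariants_def)
qed

lemma subst_in_subalgebra:
  assumes A: "subalgebra \<Omega> A" and \<phi>: "\<And>x. \<phi> x \<in> A" and f: "f \<in> free_algebra \<Omega>"
  shows "subst \<phi> f \<in> A"
proof -
  have "subst_mon \<phi> u \<in> A" if "u \<in> monomials \<Omega>" for u
    using that
  proof induction
    case (Op \<nu> us)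
    have "oper \<nu> fs \<in> A" if "\<nu> \<in> \<Omega> (length fs)" "set fs \<subseteq> A" for fs
      using A that by (simp add: subalgebra_def)
    from this[of "map (subst_mon \<phi>) us"] Op show ?case
      by auto
  qed (simp add: \<phi>)
  then show ?thesis
    using A f unfolding subst_def subalgebra_def free_algebra_def
    by (intro lincomb.subspace_sum lincomb.subspace_scale) auto
qed

text \<open>
  With \<open>P\<close> a projection onto the fixed vectors, \<open>P(f)\<close> is an obvious invariant, as it arises
  from \<open>f\<close> by substituting fixed vectors for the variables. Hence \<open>P\<close> moves a nonobvious
  \<open>f\<close>, and so moves some slot of some component of \<open>f\<close>.
\<close>

lemma ex_nonfixed_slot:
  fixes f :: "('o, 'd::finite, 'k::field) lincomb"
  assumes f: "f \<in> nonobvious_invariants \<Omega> G"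
  obtains s xs ys where
    "s \<in> monomials \<Omega>"
    "length (leaves s) = Suc (length xs + length ys)"
    "(\<chi> j. component s f (xs @ j # ys)) \<notin> fixed_vectors G"
proof -
  obtain P :: "'k ^ 'd ^ 'd"
    where P: "\<And>a. P *v a \<in> fixed_vectors G" "\<And>a. a \<in> fixed_vectors G \<Longrightarrow> P *v a = a"
    using ex_projection_onto_subspace[OF subspace_fixed_vectors] by blast
  have "act P f \<in> obvious_invariants \<Omega> G"
    unfolding obvious_invariants_def hull_def
  proof (rule InterI)
    fix A assume "A \<in> {t. subalgebra \<Omega> t \<and> linear_invariants G \<subseteq> t}"
    then have A: "subalgebra \<Omega> A" "linear_invariants G \<subseteq> A" by auto
    have "(\<Sum>i\<in>UNIV. smult (P $ i $ j) (var i)) \<in> A" for j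
    proof -
      have "(P *v axis j 1) $ i = P $ i $ j" for i
        by (simp add: matrix_vector_mult_def axis_def if_distrib[of "(*) _"] cong: if_cong)
      then show ?thesis
        using linear_form_in_linear_invariants[OF P(1)[of "axis j 1"]] A(2) by auto
    qed
    then show "act P f \<in> A"
      unfolding act_def using A(1) f
      by (intro subst_in_subalgebra) (auto simp: nonobvious_invariants_def invariants_def)
  qed
  with f have "act P f \<noteq> f"
    by (auto simp: nonobvious_invariants_def)
  then obtain v where v: "Poly_Mapping.lookup (act P f) v \<noteq> Poly_Mapping.lookup f v"
    by (meson poly_mapping_eqI)
  then have "tensor_act P (component (shape v) f) (leaves v) \<noteq> component (shape v) f (leaves v)"
    by (simp add: lookup_act component_def)
  then obtain xs ys where len: "Suc (length xs + length ys) = length (leaves v)"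
    and "P *v (\<chi> j. component (shape v) f (xs @ j # ys)) \<noteq> (\<chi> j. component (shape v) f (xs @ j # ys))"
    using tensor_act_eq_if_slots_fixed by blast
  with P(2) have slot: "(\<chi> j. component (shape v) f (xs @ j # ys)) \<notin> fixed_vectors G"
    by blast
  then have "(\<chi> j. component (shape v) f (xs @ j # ys)) \<noteq> 0"
    using vec.subspace_0[OF subspace_fixed_vectors[of G]] by auto
  then obtain j where "Poly_Mapping.lookup f (fill (shape v) (xs @ j # ys)) \<noteq> 0"
    by (auto simp: vec_eq_iff component_def)
  then have "fill (shape v) (xs @ j # ys) \<in> monomials \<Omega>"
    using f by (auto simp: nonobvious_invariants_def invariants_def free_algebra_def in_keys_iff)
  then have "shape (fill (shape v) (xs @ j # ys)) \<in> monomials \<Omega>"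
    by simp
  then have "shape v \<in> monomials \<Omega>"
    using len by (subst (asm) shape_fill) simp_all
  with len slot show thesis
    by (intro that[of "shape v"]) simp_all
qed

section \<open>Shapes with a leading leaf\<close>

text \<open>
  The tree \<open>T'\<close> contains the operations of \<open>u\<close> and those of \<open>T\<close>. Each \<open>m\<close>-ary operation
  adds \<open>m - 1\<close> leaves, which determines the number of leaves of \<open>T'\<close>. The operations of
  \<open>u\<close> are arranged as a right comb above \<open>T\<close>: all arguments but the last are single leaves, and as
  arities are at least 2, the first argument is one of these.
\<close>

lemma ex_grafted_shape:
  fixes u T :: "('o, unit) mon"
  assumes \<Omega>: "signature \<Omega>" and u: "u \<in> monomials \<Omega>" and T: "T \<in> monomials \<Omega>"
  shows "\<exists>T'\<in>monomials \<Omega>. Suc (length (leaves T')) = length (leaves u) + length (leaves T) \<and>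
    (u = Var () \<or> (\<exists>\<nu> ts. T' = Op \<nu> (Var () # ts)))"
  using u T
proof (induction arbitrary: T)
  case (Var x)
  then show ?case by auto
next
  case (Op \<nu> us)
  have "\<exists>T1\<in>(monomials \<Omega> :: ('o, unit) mon set). length us + length (leaves T1) =
      length (concat (map leaves us)) + length (leaves T)"
    using Op.IH
  proof (induction us)
    case Nil
    show ?case by (rule bexI[of _ T]) (simp_all add: Op.prems)
  next
    case (Cons u us)
    then obtain T1 :: "('o, unit) mon" where T1: "T1 \<in> monomials \<Omega>"
      "length us + length (leaves T1) = length (concat (map leaves us)) + length (leaves T)"
      by auto
    from Cons.prems T1(1) obtain T2 :: "('o, unit) mon" where "T2 \<in> monomials \<Omega>"
      "Suc (length (leaves T2)) = length (leaves u) + length (leaves T1)"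
      by (meson list.set_intros(1))
    with T1(2) show ?case by (intro bexI[of _ T2]) simp_all
  qed
  then obtain T1 :: "('o, unit) mon" where T1: "T1 \<in> monomials \<Omega>"
    "length us + length (leaves T1) = length (concat (map leaves us)) + length (leaves T)"
    by blast
  have "\<not> length us < 2"
    using \<Omega> Op.hyps by (auto simp: signature_def)
  then obtain m where m: "length us = Suc (Suc m)"
    by (metis One_nat_def Suc_1 Suc_lessI less_Suc0 not0_implies_Suc not_less_eq)
  let ?T = "Op \<nu> (Var () # replicate m (Var ()) @ [T1])"
  have "?T \<in> monomials \<Omega>"
    using T1(1) Op.hyps m by (auto simp: monomials_Op_iff intro: monomials.Var)
  moreover have "length (concat (map leaves (replicate m (Var () :: ('o, unit) mon)))) = m"
    by (induction m) simp_all
  then have "Suc (length (leaves ?T)) = length (leaves (Op \<nu> us)) + length (leaves T)"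
    using T1(2) m by simp
  ultimately show ?case by blast
qed

text \<open>Grafting \<open>Suc k\<close> copies of \<open>u\<close> on top of each other.\<close>

lemma ex_shape_with_leading_leaf:
  fixes u :: "('o, unit) mon"
  assumes "signature \<Omega>" "u \<in> monomials \<Omega>" "length (leaves u) = Suc p" "p > 0"
  shows "\<exists>\<nu> ts. Op \<nu> (Var () # ts) \<in> monomials \<Omega> \<and>
    length (leaves (Op \<nu> (Var () # ts))) = Suc (p * Suc k)"
proof (induction k)
  case 0
  then show ?case
    using ex_grafted_shape[OF assms(1,2) monomials.Var[of "()"]] assms(3,4) by fastforce
next
  case (Suc k)
  then obtain \<nu> ts where T: "Op \<nu> (Var () # ts) \<in> monomials \<Omega>"
    "length (leaves (Op \<nu> (Var () # ts))) = Suc (p * Suc k)"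
    by blast
  from ex_grafted_shape[OF assms(1,2) T(1)] T(2) assms(3,4)
  obtain T' where T': "T' \<in> monomials \<Omega>" "Suc (length (leaves T')) = Suc p + Suc (p * Suc k)"
    "\<exists>\<nu> ts. T' = Op \<nu> (Var () # ts)"
    by (metis leaves.simps(1) length_Cons list.size(3) nat.inject nless_le)
  then have "length (leaves T') = Suc (p * Suc (Suc k))"
    by simp
  with T' show ?case by blast
qed

section \<open>A subalgebra that misses large invariants\<close>

lemma oper_in_free_algebra:
  assumes "\<nu> \<in> \<Omega> (length fs)" "set fs \<subseteq> free_algebra \<Omega>"
  shows "oper \<nu> fs \<in> free_algebra \<Omega>"
  unfolding free_algebra_def
proof (intro CollectI subsetI)
  fix v assume v: "v \<in> Poly_Mapping.keys (oper \<nu> fs)"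
  then obtain us where us: "v = Op \<nu> us" "length us = length fs"
    "prod_list (map2 Poly_Mapping.lookup fs us) \<noteq> 0"
    by (cases v) (auto simp: in_keys_iff lookup_oper_Var lookup_oper_Op split: if_splits)
  have "u \<in> monomials \<Omega>" if "u \<in> set us" for u
    using us(2,3) assms(2) that
  proof (induction us fs rule: list_induct2)
    case (Cons u' us f fs)
    then show ?case by (auto simp: free_algebra_def in_keys_iff)
  qed simp
  with us assms(1) show "v \<in> monomials \<Omega>"
    by (simp add: monomials_Op_iff)
qed

text \<open>
  The coefficient of \<open>\<mu>(f\<^sub>1, \<dots>, f\<^sub>m)\<close> at \<open>\<mu>(x\<^sub>j, vs)\<close> is the coefficient of \<open>f\<^sub>1\<close> at
  \<open>x\<^sub>j\<close> times a scalar independent of \<open>j\<close>. So closure under the operations follows from the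
  condition on the linear parts alone.
\<close>

lemma subalgebra_leading_leaf_fixed:
  fixes G :: "('k::field ^ 'd::finite ^ 'd) set" and vs :: "('o, 'd) mon list"
  shows "subalgebra \<Omega> {f \<in> free_algebra \<Omega>.
    (\<chi> j. Poly_Mapping.lookup f (Var j)) \<in> fixed_vectors G \<and>
    (\<chi> j. Poly_Mapping.lookup f (Op \<mu> (Var j # vs))) \<in> fixed_vectors G}"
    (is "subalgebra \<Omega> ?A")
proof -
  let ?W = "fixed_vectors G"
  note W = vec.subspace_0 vec.subspace_add vec.subspace_scale
  note W = W[OF subspace_fixed_vectors[of G]]
  have add: "(\<chi> j. Poly_Mapping.lookup (f + g) (u j)) = (\<chi> j. Poly_Mapping.lookup f (u j)) + (\<chi> j. Poly_Mapping.lookup g (u j))"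
    for f g :: "('o, 'd, 'k) lincomb" and u
    by (simp add: vec_eq_iff lookup_add)
  have scale: "(\<chi> j. Poly_Mapping.lookup (smult a f) (u j)) = a *s (\<chi> j. Poly_Mapping.lookup f (u j))"
    for a and f :: "('o, 'd, 'k) lincomb" and u
    by (simp add: vec_eq_iff lookup_smult)
  have zero: "(\<chi> j. 0) \<in> ?W"
    using W(1) by (simp add: zero_vec_def)
  have free: "lincomb.subspace (free_algebra \<Omega> :: ('o, 'd, 'k) lincomb set)"
    unfolding lincomb.subspace_def free_algebra_def
    by (auto simp: in_keys_iff lookup_add lookup_smult subset_iff) (metis add.right_neutral)
  have "lincomb.subspace ?A"
    unfolding lincomb.subspace_def
    using W zero free by (auto simp: add scale lincomb.subspace_def)
  moreover have "oper \<nu> fs \<in> ?A" if \<nu>: "\<nu> \<in> \<Omega> (length fs)" and fs: "set fs \<subseteq> ?A" for \<nu> fs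
  proof -
    have "(\<chi> j. Poly_Mapping.lookup (oper \<nu> fs) (Op \<mu> (Var j # vs))) \<in> ?W"
    proof (cases "\<mu> = \<nu> \<and> Suc (length vs) = length fs")
      case True
      then obtain f fs' where fs': "fs = f # fs'" by (cases fs) auto
      have "(\<chi> j. Poly_Mapping.lookup (oper \<nu> fs) (Op \<mu> (Var j # vs))) =
          prod_list (map2 Poly_Mapping.lookup fs' vs) *s (\<chi> j. Poly_Mapping.lookup f (Var j))"
        using True fs' by (simp add: vec_eq_iff lookup_oper_Op)
      also have "\<dots> \<in> ?W"
        using fs fs' by (intro W(3)) auto
      finally show ?thesis .
    qed (use zero in \<open>auto simp: lookup_oper_Op\<close>)
    moreover have "oper \<nu> fs \<in> free_algebra \<Omega>"
      using oper_in_free_algebra[of \<nu> \<Omega> fs] \<nu> fs by auto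
    ultimately show ?thesis
      using zero by (simp add: lookup_oper_Var)
  qed
  ultimately show ?thesis
    by (auto simp: subalgebra_def)
qed

text \<open>
  The invariant is \<open>c' \<otimes> c\<^sup>\<otimes>\<^sup>m\<close> on a shape with a leading leaf, where \<open>c\<close> is a component of a
  nonobvious invariant and \<open>c'\<close> is \<open>c\<close> with a nonfixed slot moved to the front. Evaluating all
  other slots at a word where \<open>c\<close> does not vanish leaves a nonzero multiple of that slot.
\<close>

lemma ex_large_invariant_with_nonfixed_leading_leaf:
  fixes \<Omega> :: "nat \<Rightarrow> 'o set" and G :: "('k::field ^ 'd::finite ^ 'd) set"
  assumes \<Omega>: "signature \<Omega>" and nonobv: "nonobvious_invariants \<Omega> G \<noteq> {}"
  obtains f \<mu> vs where
    "f \<in> invariants \<Omega> G"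
    "(\<chi> j. Poly_Mapping.lookup f (Op \<mu> (Var j # vs))) \<notin> fixed_vectors G"
    "\<And>j. length (leaves (Op \<mu> (Var j # vs))) > B"
proof -
  obtain f s xs ys where f: "f \<in> invariants \<Omega> G" and s: "s \<in> monomials \<Omega>"
    and len: "length (leaves s) = Suc (length xs + length ys)"
    and slot: "(\<chi> j. component s f (xs @ j # ys)) \<notin> fixed_vectors G"
    using nonobv ex_nonfixed_slot by (metis Diff_iff all_not_in_conv nonobvious_invariants_def)
  define c where "c = component s f"
  define p where "p = length xs + length ys"
  have c: "tensor_invariant G (Suc p) c"
    using tensor_invariant_component[OF f, of s] len by (simp add: c_def p_def)
  have "p > 0"
  proof (rule ccontr)
    assume "\<not> p > 0"
    then show False
      using c slot tensor_invariant_degree_1_iff[of G c] by (simp add: p_def c_def)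
  qed
  have "(\<chi> j. c (xs @ j # ys)) \<noteq> 0"
    using slot vec.subspace_0[OF subspace_fixed_vectors[of G]] by (auto simp: c_def)
  then obtain k where k: "c (xs @ k # ys) \<noteq> 0"
    by (auto simp: vec_eq_iff)
  \<comment> \<open>The tensor will have degree \<open>(p + 1)(1 + m)\<close>, while shapes with a leading leaf are available for
    the degrees \<open>1 + p(1 + k)\<close>. For \<open>m = p(B + 1)\<close> and \<open>k = (p + 1)(B + 1)\<close> these agree.\<close>
  define m where "m = p * Suc B"
  obtain \<mu> ts where T: "Op \<mu> (Var () # ts) \<in> monomials \<Omega>"
    and "length (leaves (Op \<mu> (Var () # ts))) = Suc (p * Suc (Suc p * Suc B))"
    using ex_shape_with_leading_leaf[OF \<Omega> s _ \<open>p > 0\<close>] len p_def by blast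
  moreover have "Suc (p * Suc (Suc p * Suc B)) = Suc p + Suc p * m"
    by (simp add: m_def algebra_simps)
  ultimately have lenT: "length (leaves (Op \<mu> (Var () # ts))) = Suc p + Suc p * m"
    by simp
  define d where "d = tensor_prod (Suc p) (slot_to_front (length xs) c) (tensor_power (Suc p) c m)"
  define h where "h = realize (Op \<mu> (Var () # ts)) d"
  have "tensor_invariant G (Suc p + Suc p * m) d"
    unfolding d_def using c
    by (intro tensor_invariant_prod tensor_invariant_power tensor_invariant_slot_to_front)
      (simp_all add: p_def)
  then have h: "h \<in> invariants \<Omega> G"
    unfolding h_def using T lenT by (intro realize_in_invariants) simp_all
  define w where "w = xs @ ys @ concat (replicate m (xs @ k # ys))"
  have lenw: "Suc (length w) = Suc p + Suc p * m"
    by (simp add: w_def p_def length_concat sum_list_replicate algebra_simps)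
  obtain vs where vs: "map shape vs = ts" "concat (map leaves vs) = w"
  proof -
    obtain u where "shape u = Op \<mu> (Var () # ts)" "leaves u = k # w"
      using ex_shape_leaves[of "k # w" "Op \<mu> (Var () # ts)"] lenT lenw by auto
    then show thesis
      using that by (auto simp: shape_eq_Op_iff map_eq_Cons_conv)
  qed
  have "Poly_Mapping.lookup h (Op \<mu> (Var j # vs)) = c (xs @ k # ys) ^ m * c (xs @ j # ys)" for j
  proof -
    have "slot_to_front (length xs) c (j # xs @ ys) = c (xs @ j # ys)"
      by (simp add: slot_to_front_def)
    moreover have "tensor_power (Suc p) c m (concat (replicate m (xs @ k # ys))) = c (xs @ k # ys) ^ m"
      by (rule tensor_power_concat_replicate) (simp add: p_def)
    moreover have "take (Suc p) (j # w) = j # xs @ ys"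
        "drop (Suc p) (j # w) = concat (replicate m (xs @ k # ys))"
      by (simp_all add: w_def p_def)
    ultimately have "d (j # w) = c (xs @ k # ys) ^ m * c (xs @ j # ys)"
      by (simp only: d_def tensor_prod_def mult.commute)
    then show ?thesis
      by (simp add: h_def lookup_realize vs)
  qed
  then have "(\<chi> j. Poly_Mapping.lookup h (Op \<mu> (Var j # vs))) =
      c (xs @ k # ys) ^ m *s (\<chi> j. c (xs @ j # ys))"
    by (simp add: vec_eq_iff)
  moreover have "\<dots> \<notin> fixed_vectors G"
  proof
    assume "c (xs @ k # ys) ^ m *s (\<chi> j. c (xs @ j # ys)) \<in> fixed_vectors G"
    from vec.subspace_scale[OF subspace_fixed_vectors this, of "inverse (c (xs @ k # ys) ^ m)"]
    show False
      using slot k by (simp add: c_def vector_smult_assoc)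
  qed
  moreover have "length (leaves (Op \<mu> (Var j # vs))) > B" for j
  proof -
    have "Suc B \<le> m" using \<open>p > 0\<close> by (cases p) (simp_all add: m_def)
    then show ?thesis using lenw by (simp add: vs)
  qed
  ultimately show thesis
    using that[OF h] by metis
qed

theorem theorem4p4:
  fixes \<Omega> :: "nat \<Rightarrow> 'o set"
    and G :: "('k::field_char_0 ^ 'd::finite ^ 'd) set"
  assumes "signature \<Omega>"
    and "subgroup G GL"
    and "nonobvious_invariants \<Omega> G \<noteq> {}"
  shows "\<not> finitely_generated \<Omega> (invariants \<Omega> G)"
proof
  assume "finitely_generated \<Omega> (invariants \<Omega> G)"
  then obtain S :: "('o, 'd, 'k) lincomb set"
    where S: "finite S" "S \<subseteq> invariants \<Omega> G" and gen: "invariants \<Omega> G = subalgebra \<Omega> hull S"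
    unfolding finitely_generated_def by blast
  define B where "B = Max ((length \<circ> leaves) ` (\<Union>f\<in>S. Poly_Mapping.keys f))"
  have B: "length (leaves u) \<le> B" if "f \<in> S" "u \<in> Poly_Mapping.keys f" for f u
    unfolding B_def using S(1) that by (intro Max_ge) auto
  obtain h \<mu> and vs :: "('o, 'd) mon list" where h: "h \<in> invariants \<Omega> G"
    and nonfixed: "(\<chi> j. Poly_Mapping.lookup h (Op \<mu> (Var j # vs))) \<notin> fixed_vectors G"
    and large: "\<And>j. length (leaves (Op \<mu> (Var j # vs))) > B"
    using ex_large_invariant_with_nonfixed_leading_leaf[OF assms(1,3)] by blast
  define A :: "('o, 'd, 'k) lincomb set" where "A = {f \<in> free_algebra \<Omega>.
    (\<chi> j. Poly_Mapping.lookup f (Var j)) \<in> fixed_vectors G \<and>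
    (\<chi> j. Poly_Mapping.lookup f (Op \<mu> (Var j # vs))) \<in> fixed_vectors G}"
  have "S \<subseteq> A"
  proof
    fix f assume "f \<in> S"
    then have f: "f \<in> invariants \<Omega> G" using S(2) by blast
    have "component (Var ()) f [j] = Poly_Mapping.lookup f (Var j)" for j
      using fill_shape_leaves[of "Var j :: ('o, 'd) mon"] by (simp add: component_def)
    then have "(\<chi> j. Poly_Mapping.lookup f (Var j)) \<in> fixed_vectors G"
      using tensor_invariant_component[OF f, of "Var ()"] tensor_invariant_degree_1_iff[of G]
      by simp
    moreover have "Poly_Mapping.lookup f (Op \<mu> (Var j # vs)) = 0" for j
      using B[OF \<open>f \<in> S\<close>] large[of j] by (meson in_keys_iff leD)
    then have "(\<chi> j. Poly_Mapping.lookup f (Op \<mu> (Var j # vs))) = 0"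
      by (simp add: vec_eq_iff)
    ultimately show "f \<in> A"
      using f vec.subspace_0[OF subspace_fixed_vectors[of G]]
      by (simp add: A_def invariants_def)
  qed
  then have "subalgebra \<Omega> hull S \<subseteq> A"
    unfolding A_def by (rule hull_minimal) (rule subalgebra_leading_leaf_fixed)
  with h nonfixed gen show False
    by (auto simp: A_def)
qed

end
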